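(* Let $F_1,\dots,F_n:\mathbb{R}^d\to\mathbb{R}$, $\lambda\ge0$, $\theta\in(0,1)$, and let $F_\theta(w)=\mathbb{S}_\theta(F_1(w),\dots,F_n(w))+\frac{\lambda}{2}\|w\|^2$, where $\mathbb{S}_\theta(a_1,\dots,a_n)$ is the $(1-\theta)$-superquantile of the empirical distribution of $a_1,\dots,a_n$. Then for every $w\in\mathbb{R}^d$, $$F_\theta(w)=\max_{\pi\in\mathcal{P}_\theta}\sum_{i=1}^n\pi_iF_i(w)+\frac{\lambda}{2}\|w\|^2,\qquad\text{where}\quad\mathcal{P}_\theta=\left\{\pi\in\Delta^{n-1}:\ \pi_i\le(n\theta)^{-1}\text{ for all }i\in\{1,\dots,n\}\right\}.$$
   Context: $\Delta^{n-1}=\{\pi\in\mathbb{R}^n_+:\sum_{i=1}^n\pi_i=1\}$ is the probability simplex. For a real random variable $Z$, the $(1-\theta)$-quantile is $Q_\theta(Z)=\inf\{\eta\in\mathbb{R}:\mathbb{P}(Z>\eta)\le\theta\}$ and the $(1-\theta)$-superquantile is $\mathbb{S}_\theta(Z)=\frac1\theta\int_0^\theta Q_\alpha(Z)\,d\alpha$. $\mathbb{S}_\theta(a_1,\dots,a_n)$ denotes the superquantile of a random variable with law $\frac1n\sum_{i=1}^n\delta_{a_i}$. *)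

theory Defs
  imports "HOL-Probability.Probability"
begin

text \<open>\<open>quantile M Z \<theta>\<close> is the upper quantile \<open>Q\<^sub>\<theta>(Z)\<close>, i.e. the quantile of level \<open>1 - \<theta>\<close>;
  likewise for \<open>superquantile\<close>. The endpoint \<open>\<alpha> = 0\<close>, where the set below may be empty if
  \<open>Z\<close> is unbounded, does not affect the integral.\<close>

definition quantile :: "'s measure \<Rightarrow> ('s \<Rightarrow> real) \<Rightarrow> real \<Rightarrow> real" where
  "quantile M Z \<theta> = Inf {\<eta>. measure M {x \<in> space M. Z x > \<eta>} \<le> \<theta>}"

definition superquantile :: "'s measure \<Rightarrow> ('s \<Rightarrow> real) \<Rightarrow> real \<Rightarrow> real" where
  "superquantile M Z \<theta> = 1 / \<theta> * (LBINT \<alpha>:{0..\<theta>}. quantile M Z \<alpha>)"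

definition empirical_law :: "('n::finite \<Rightarrow> real) \<Rightarrow> real pmf" where
  "empirical_law a = map_pmf a (pmf_of_set UNIV)"

text \<open>The law is the average of the Dirac measures at the \<open>a i\<close>, counted with multiplicity.\<close>

lemma measure_empirical_law:
  fixes a :: "'n::finite \<Rightarrow> real"
  shows "measure (empirical_law a) A = 1 / real CARD('n) * (\<Sum>i\<in>UNIV. indicator A (a i))"
proof -
  have "measure (empirical_law a) A = real (card (a -` A)) / real CARD('n)"
    by (simp add: empirical_law_def measure_pmf_of_set)
  also have "real (card (a -` A)) = (\<Sum>i\<in>UNIV. indicator (a -` A) i)"
    using sum_indicator_eq_card[of "UNIV :: 'n set" "a -` A", symmetric]
    by (simp add: indicator_def flip: of_nat_sum)
  also have "\<dots> = (\<Sum>i\<in>UNIV. indicator A (a i))"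
    by (simp add: indicator_def)
  finally show ?thesis by simp
qed

definition empirical_superquantile :: "real \<Rightarrow> ('n::finite \<Rightarrow> real) \<Rightarrow> real" where
  "empirical_superquantile \<theta> a = superquantile (empirical_law a) (\<lambda>z. z) \<theta>"

definition superquantile_objective ::
    "('n::finite \<Rightarrow> real ^ 'd \<Rightarrow> real) \<Rightarrow> real \<Rightarrow> real \<Rightarrow> real ^ 'd \<Rightarrow> real" where
  "superquantile_objective F lam \<theta> w =
     empirical_superquantile \<theta> (\<lambda>i. F i w) + lam / 2 * (norm w)\<^sup>2"

definition prob_simplex :: "(real ^ 'n) set" where
  "prob_simplex = {\<pi>. (\<forall>i. 0 \<le> \<pi> $ i) \<and> (\<Sum>i\<in>UNIV. \<pi> $ i) = 1}"

definition capped_simplex :: "real \<Rightarrow> (real ^ 'n) set" where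
  "capped_simplex \<theta> = {\<pi> \<in> prob_simplex. \<forall>i. \<pi> $ i \<le> inverse (real CARD('n) * \<theta>)}"

end

theory Submission
  imports Defs
begin

text \<open>Rank the indices by decreasing value: \<open>a i\<close> is then the upper quantile of every level
  in the block \<open>[\<sigma> i / n, (\<sigma> i + 1) / n)\<close>, where \<open>\<sigma> i\<close> is the rank of \<open>i\<close>. Integrating over
  \<open>[0, \<theta>]\<close> exhibits the superquantile as \<open>\<Sum>i. \<pi> i * a i\<close>, where \<open>\<theta> * \<pi> i\<close> is the length of the
  part of the block of \<open>i\<close> that lies in \<open>[0, \<theta>]\<close>. If \<open>k\<close> is the index whose block contains
  \<open>\<theta>\<close>, then \<open>\<pi>\<close> attains the cap at the indices ranked before \<open>k\<close> and vanishes at those ranked after,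
  so \<open>(\<pi> i - p i) * (a i - a k) \<ge> 0\<close> for every competitor \<open>p\<close> and every \<open>i\<close>.\<close>

section \<open>Rankings and the blocks of levels they determine\<close>

text \<open>Ranks start at 0. The implication goes one way only, so indices with equal values may be
  ranked in any order.\<close>

definition decreasing_ranking :: "('n::finite \<Rightarrow> real) \<Rightarrow> ('n \<Rightarrow> nat) \<Rightarrow> bool" where
  "decreasing_ranking a \<sigma> \<longleftrightarrow> bij_betw \<sigma> UNIV {..<CARD('n)} \<and> (\<forall>i j. \<sigma> i \<le> \<sigma> j \<longrightarrow> a j \<le> a i)"

text \<open>Blocks are closed on the left because the quantile uses the non-strict condition P(Z >
  \<eta>) \<le> \<alpha>: at a jump it already takes its new value.\<close>

definition rank_block :: "('n::finite \<Rightarrow> nat) \<Rightarrow> 'n \<Rightarrow> real set" where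
  "rank_block \<sigma> i = {real (\<sigma> i) / real CARD('n) ..< (real (\<sigma> i) + 1) / real CARD('n)}"

definition block_weight :: "('n::finite \<Rightarrow> nat) \<Rightarrow> real \<Rightarrow> 'n \<Rightarrow> real" where
  "block_weight \<sigma> \<theta> i = measure lborel ({0..\<theta>} \<inter> rank_block \<sigma> i)"

text \<open>Sort a repetition-free list of all indices by \<open>- a i\<close>; the rank of an index
  is its position in the sorted list.\<close>

lemma decreasing_ranking_exists:
  fixes a :: "'n::finite \<Rightarrow> real"
  shows "\<exists>\<sigma>. decreasing_ranking a \<sigma>"
proof -
  obtain ys :: "'n list" where ys: "set ys = UNIV" "distinct ys"
    using finite_distinct_list[OF finite] by blast
  define xs where "xs = sort_key (\<lambda>i. - a i) ys"
  have xs: "set xs = UNIV" "distinct xs" "sorted (map (\<lambda>i. - a i) xs)"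
    using ys by (simp_all add: xs_def)
  have len: "length xs = CARD('n)"
    using distinct_card[OF xs(2)] xs(1) by simp
  have nth: "bij_betw ((!) xs) {..<CARD('n)} UNIV"
    using bij_betw_nth[OF xs(2)] xs(1) len by simp
  define \<sigma> where "\<sigma> = inv_into {..<CARD('n)} ((!) xs)"
  have \<sigma>: "bij_betw \<sigma> UNIV {..<CARD('n)}"
    unfolding \<sigma>_def by (rule bij_betw_inv_into[OF nth])
  have nth_\<sigma>: "xs ! \<sigma> i = i" for i
    using bij_betw_inv_into_right[OF nth] by (simp add: \<sigma>_def)
  have "a j \<le> a i" if "\<sigma> i \<le> \<sigma> j" for i j
  proof -
    have "\<sigma> j < length xs"
      using \<sigma> len by (auto simp: bij_betw_def)
    then show ?thesis
      using sorted_nth_mono[OF xs(3) that] that by (simp add: nth_\<sigma>)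
  qed
  with \<sigma> show ?thesis
    unfolding decreasing_ranking_def by blast
qed

text \<open>Scaling by n turns a block into a unit interval with integer endpoints, so membership is
  a floor condition. Nonnegativity of \<open>\<alpha>\<close> keeps \<open>nat\<close> from sending
  a negative floor to rank 0.\<close>

lemma rank_block_iff:
  fixes \<sigma> :: "'n::finite \<Rightarrow> nat"
  assumes "0 \<le> \<alpha>"
  shows "\<alpha> \<in> rank_block \<sigma> i \<longleftrightarrow> \<sigma> i = nat \<lfloor>real CARD('n) * \<alpha>\<rfloor>"
proof -
  have "\<alpha> \<in> rank_block \<sigma> i \<longleftrightarrow> real (\<sigma> i) \<le> real CARD('n) * \<alpha> \<and> real CARD('n) * \<alpha> < real (\<sigma> i) + 1"
    by (simp add: rank_block_def field_simps)
  also have "\<dots> \<longleftrightarrow> \<lfloor>real CARD('n) * \<alpha>\<rfloor> = int (\<sigma> i)"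
    by (simp add: floor_eq_iff)
  also have "\<dots> \<longleftrightarrow> \<sigma> i = nat \<lfloor>real CARD('n) * \<alpha>\<rfloor>"
    using assms by auto
  finally show ?thesis .
qed

lemma rank_block_ex:
  fixes \<sigma> :: "'n::finite \<Rightarrow> nat"
  assumes "bij_betw \<sigma> UNIV {..<CARD('n)}" "0 \<le> \<alpha>" "\<alpha> < 1"
  obtains k where "\<alpha> \<in> rank_block \<sigma> k"
proof -
  have "real CARD('n) * \<alpha> < real CARD('n)"
    using assms by simp
  then have "nat \<lfloor>real CARD('n) * \<alpha>\<rfloor> \<in> {..<CARD('n)}"
    using assms(2) by (simp add: nat_less_iff floor_less_iff)
  then obtain k where "\<sigma> k = nat \<lfloor>real CARD('n) * \<alpha>\<rfloor>"
    using assms(1) unfolding bij_betw_def by (metis imageE)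
  then show ?thesis
    using that rank_block_iff[OF assms(2)] by blast
qed

lemma rank_block_disjoint:
  fixes \<sigma> :: "'n::finite \<Rightarrow> nat"
  assumes "inj \<sigma>" "0 \<le> \<alpha>" "\<alpha> \<in> rank_block \<sigma> i" "\<alpha> \<in> rank_block \<sigma> j"
  shows "i = j"
  using assms by (simp add: rank_block_iff inj_eq[symmetric])

section \<open>Quantile and superquantile of the empirical law\<close>

lemma measure_empirical_law_greaterThan:
  fixes a :: "'n::finite \<Rightarrow> real"
  shows "measure (empirical_law a) {x \<in> space (empirical_law a). \<eta> < x}
    = real (card {j. \<eta> < a j}) / real CARD('n)"
  by (simp add: empirical_law_def measure_pmf_of_set vimage_def)

text \<open>If \<open>a i \<le> \<eta>\<close>, only indices ranked before \<open>i\<close> can have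
  values above \<open>\<eta>\<close>; otherwise all indices of rank at most
  \<open>\<sigma> i\<close> do. As n\<alpha> lies in [\<sigma> i, \<sigma> i + 1), the count is at
  most n\<alpha> exactly in the first case, and the infimum is over the half-line
  \<open>{a i..}\<close>.\<close>

lemma quantile_empirical_law:
  fixes a :: "'n::finite \<Rightarrow> real"
  assumes \<sigma>: "decreasing_ranking a \<sigma>" and \<alpha>: "\<alpha> \<in> rank_block \<sigma> i"
  shows "quantile (empirical_law a) (\<lambda>z. z) \<alpha> = a i"
proof -
  have inj: "inj \<sigma>" and mono: "\<And>i j. \<sigma> i \<le> \<sigma> j \<Longrightarrow> a j \<le> a i"
    and surj: "range \<sigma> = {..<CARD('n)}"
    using \<sigma> by (auto simp: decreasing_ranking_def bij_betw_def)
  have lo: "real (\<sigma> i) \<le> \<alpha> * real CARD('n)" and hi: "\<alpha> * real CARD('n) < real (Suc (\<sigma> i))"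
    using \<alpha> by (simp_all add: rank_block_def field_simps)
  have "card {j. \<eta> < a j} \<le> \<alpha> * real CARD('n) \<longleftrightarrow> a i \<le> \<eta>" for \<eta>
  proof
    assume "a i \<le> \<eta>"
    then have "\<sigma> ` {j. \<eta> < a j} \<subseteq> {..<\<sigma> i}"
      using mono by (force simp: not_le[symmetric])
    then have "card {j. \<eta> < a j} \<le> \<sigma> i"
      by (metis card_image card_lessThan card_mono finite_lessThan inj inj_on_subset subset_UNIV)
    with lo show "card {j. \<eta> < a j} \<le> \<alpha> * real CARD('n)"
      by linarith
  next
    assume card: "card {j. \<eta> < a j} \<le> \<alpha> * real CARD('n)"
    show "a i \<le> \<eta>"
    proof (rule ccontr)
      assume "\<not> a i \<le> \<eta>"
      have "\<sigma> i < CARD('n)"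
        using surj by blast
      then have "{..\<sigma> i} \<subseteq> range \<sigma>"
        by (auto simp: surj)
      moreover have "\<eta> < a j" if "\<sigma> j \<le> \<sigma> i" for j
        using mono[OF that] \<open>\<not> a i \<le> \<eta>\<close> by linarith
      ultimately have "{..\<sigma> i} \<subseteq> \<sigma> ` {j. \<eta> < a j}"
        by fastforce
      \<comment> \<open>Ranks start at 0, so \<open>{..\<sigma> i}\<close> has
        \<open>Suc (\<sigma> i)\<close> elements, which already exceeds n\<alpha>.\<close>
      then have "Suc (\<sigma> i) \<le> card {j. \<eta> < a j}"
        by (metis card_atMost surj_card_le finite)
      with card hi show False
        by linarith
    qed
  qed
  then have "{\<eta>. measure (empirical_law a) {x \<in> space (empirical_law a). \<eta> < x} \<le> \<alpha>} = {a i..}"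
    unfolding measure_empirical_law_greaterThan by (auto simp: divide_le_eq)
  then show ?thesis
    by (simp add: quantile_def)
qed

lemma block_measurable [measurable]: "{0..\<theta>} \<inter> rank_block \<sigma> i \<in> sets lborel"
  by (simp add: rank_block_def)

lemma emeasure_block_finite: "emeasure lborel ({0..\<theta>} \<inter> rank_block \<sigma> i) < \<infinity>"
  by (rule emeasure_bounded_finite) (simp add: bounded_Int)

lemma superquantile_empirical_law:
  fixes a :: "'n::finite \<Rightarrow> real"
  assumes \<sigma>: "decreasing_ranking a \<sigma>" and "\<theta> < 1"
  shows "empirical_superquantile \<theta> a = 1 / \<theta> * (\<Sum>i\<in>UNIV. block_weight \<sigma> \<theta> i * a i)"
proof -
  have bij: "bij_betw \<sigma> UNIV {..<CARD('n)}"
    using \<sigma> by (simp add: decreasing_ranking_def)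
  \<comment> \<open>The integrand is a step function: since \<open>\<theta> < 1\<close>, each level
    in the range of integration lies in exactly one block, and only that summand survives.\<close>
  have eq: "indicator {0..\<theta>} \<alpha> *\<^sub>R quantile (empirical_law a) (\<lambda>z. z) \<alpha>
      = (\<Sum>i\<in>UNIV. indicator ({0..\<theta>} \<inter> rank_block \<sigma> i) \<alpha> * a i)" for \<alpha>
  proof (cases "\<alpha> \<in> {0..\<theta>}")
    case True
    with \<open>\<theta> < 1\<close> have "0 \<le> \<alpha>" "\<alpha> < 1"
      by auto
    then obtain k where k: "\<alpha> \<in> rank_block \<sigma> k"
      using rank_block_ex[OF bij] by blast
    have "\<alpha> \<in> rank_block \<sigma> i \<longleftrightarrow> i = k" for i
      using rank_block_disjoint[OF bij_betw_imp_inj_on[OF bij] \<open>0 \<le> \<alpha>\<close>] k by blast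
    then have "(\<Sum>i\<in>UNIV. indicator ({0..\<theta>} \<inter> rank_block \<sigma> i) \<alpha> * a i)
        = (\<Sum>i\<in>UNIV. if i = k then a i else 0)"
      using True by (intro sum.cong) (auto simp: indicator_def)
    also have "\<dots> = a k"
      by simp
    finally show ?thesis
      using True quantile_empirical_law[OF \<sigma> k] by simp
  next
    case False
    then show ?thesis
      by (subst sum.neutral) auto
  qed
  have int: "integrable lborel (indicator ({0..\<theta>} \<inter> rank_block \<sigma> i) :: real \<Rightarrow> real)" for i
    by (rule integrable_real_indicator[OF block_measurable emeasure_block_finite])
  have "(LBINT \<alpha>:{0..\<theta>}. quantile (empirical_law a) (\<lambda>z. z) \<alpha>)
      = (\<Sum>i\<in>UNIV. LBINT \<alpha>. indicator ({0..\<theta>} \<inter> rank_block \<sigma> i) \<alpha> * a i)"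
    unfolding set_lebesgue_integral_def eq
    by (rule Bochner_Integration.integral_sum) (rule integrable_mult_left[OF int])
  also have "\<dots> = (\<Sum>i\<in>UNIV. block_weight \<sigma> \<theta> i * a i)"
    by (simp only: Bochner_Integration.integral_mult_left[OF int]) (simp add: block_weight_def)
  finally have "(LBINT \<alpha>:{0..\<theta>}. quantile (empirical_law a) (\<lambda>z. z) \<alpha>)
      = (\<Sum>i\<in>UNIV. block_weight \<sigma> \<theta> i * a i)" .
  then show ?thesis
    by (simp add: empirical_superquantile_def superquantile_def)
qed

section \<open>Block weights\<close>

text \<open>The blocks partition [0, 1), so their traces partition [0, \<theta>] and finite
  additivity applies.\<close>

lemma sum_block_weight:
  fixes \<sigma> :: "'n::finite \<Rightarrow> nat"
  assumes bij: "bij_betw \<sigma> UNIV {..<CARD('n)}" and "0 \<le> \<theta>" "\<theta> < 1"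
  shows "(\<Sum>i\<in>UNIV. block_weight \<sigma> \<theta> i) = \<theta>"
proof -
  have "(\<Union>i. {0..\<theta>} \<inter> rank_block \<sigma> i) = {0..\<theta>}"
  proof (intro equalityI subsetI)
    fix \<alpha> assume "\<alpha> \<in> {0..\<theta>}"
    moreover from this obtain k where "\<alpha> \<in> rank_block \<sigma> k"
      using rank_block_ex[OF bij, of \<alpha>] \<open>\<theta> < 1\<close> by auto
    ultimately show "\<alpha> \<in> (\<Union>i. {0..\<theta>} \<inter> rank_block \<sigma> i)"
      by blast
  qed blast
  moreover have "disjoint_family (\<lambda>i. {0..\<theta>} \<inter> rank_block \<sigma> i)"
    using rank_block_disjoint[OF bij_betw_imp_inj_on[OF bij]]
    by (fastforce simp: disjoint_family_on_def)
  ultimately have "measure lborel {0..\<theta>} = (\<Sum>i\<in>UNIV. block_weight \<sigma> \<theta> i)"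
    using measure_finite_Union[of UNIV "\<lambda>i. {0..\<theta>} \<inter> rank_block \<sigma> i" lborel]
      emeasure_block_finite[of \<theta> \<sigma>] block_measurable[of \<theta> \<sigma>]
    by (simp add: block_weight_def less_top image_subset_iff)
  then show ?thesis
    using \<open>0 \<le> \<theta>\<close> by simp
qed

lemma block_weight_le:
  fixes \<sigma> :: "'n::finite \<Rightarrow> nat"
  shows "block_weight \<sigma> \<theta> i \<le> 1 / real CARD('n)"
proof -
  have "block_weight \<sigma> \<theta> i \<le> measure lborel (rank_block \<sigma> i)"
    unfolding block_weight_def
    by (rule measure_mono_fmeasurable)
       (auto simp: rank_block_def intro!: fmeasurableI emeasure_bounded_finite)
  also have "\<dots> = 1 / real CARD('n)"
    by (simp add: rank_block_def divide_right_mono field_simps)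
  finally show ?thesis .
qed

text \<open>The block of \<open>i\<close> ends no later than the block of \<open>k\<close> begins,
  hence lies entirely in [0, \<theta>] and contributes its full length.\<close>

lemma block_weight_before:
  fixes \<sigma> :: "'n::finite \<Rightarrow> nat"
  assumes "\<theta> \<in> rank_block \<sigma> k" "\<sigma> i < \<sigma> k"
  shows "block_weight \<sigma> \<theta> i = 1 / real CARD('n)"
proof -
  have "(real (\<sigma> i) + 1) / real CARD('n) \<le> real (\<sigma> k) / real CARD('n)"
    using assms(2) by (intro divide_right_mono) auto
  also have "\<dots> \<le> \<theta>"
    using assms(1) by (simp add: rank_block_def)
  finally have "(real (\<sigma> i) + 1) / real CARD('n) \<le> \<theta>" .
  moreover have "0 \<le> real (\<sigma> i) / real CARD('n)"
    by simp
  ultimately have "rank_block \<sigma> i \<subseteq> {0..\<theta>}"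
    unfolding rank_block_def by (intro subsetI) (simp only: atLeastAtMost_iff atLeastLessThan_iff, linarith)
  then have "{0..\<theta>} \<inter> rank_block \<sigma> i = rank_block \<sigma> i"
    by blast
  then show ?thesis
    by (simp add: block_weight_def) (simp add: rank_block_def divide_right_mono field_simps)
qed

lemma block_weight_after:
  fixes \<sigma> :: "'n::finite \<Rightarrow> nat"
  assumes "\<theta> \<in> rank_block \<sigma> k" "\<sigma> k < \<sigma> i"
  shows "block_weight \<sigma> \<theta> i = 0"
proof -
  have "\<theta> < (real (\<sigma> k) + 1) / real CARD('n)"
    using assms(1) by (simp add: rank_block_def)
  also have "\<dots> \<le> real (\<sigma> i) / real CARD('n)"
    using assms(2) by (intro divide_right_mono) auto
  finally have "{0..\<theta>} \<inter> rank_block \<sigma> i = {}"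
    by (auto simp: rank_block_def)
  then show ?thesis
    by (simp add: block_weight_def)
qed

section \<open>Optimality over the capped simplex\<close>

text \<open>Because the total weights agree, shifting \<open>a\<close> by the constant
  \<open>c\<close> does not change the difference of the two sums.\<close>

lemma sum_mult_le_of_threshold:
  fixes p q a :: "'i \<Rightarrow> real"
  assumes "sum p A = sum q A"
    and "\<And>i. i \<in> A \<Longrightarrow> 0 \<le> (q i - p i) * (a i - c)"
  shows "(\<Sum>i\<in>A. p i * a i) \<le> (\<Sum>i\<in>A. q i * a i)"
proof -
  have "0 \<le> (\<Sum>i\<in>A. (q i - p i) * (a i - c))"
    using assms(2) by (rule sum_nonneg)
  also have "\<dots> = (\<Sum>i\<in>A. q i * a i) - (\<Sum>i\<in>A. p i * a i) - c * (sum q A - sum p A)"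
    by (simp add: algebra_simps sum.distrib sum_subtractf sum_distrib_left)
  finally show ?thesis
    using assms(1) by simp
qed

lemma superquantile_eq_max_capped_simplex:
  fixes a :: "'n::finite \<Rightarrow> real"
  assumes "0 < \<theta>" "\<theta> < 1"
  shows "\<exists>\<pi>. is_arg_max (\<lambda>p. \<Sum>i\<in>UNIV. p $ i * a i) (\<lambda>p. p \<in> capped_simplex \<theta>) \<pi>
    \<and> empirical_superquantile \<theta> a = (\<Sum>i\<in>UNIV. \<pi> $ i * a i)"
proof -
  obtain \<sigma> where \<sigma>: "decreasing_ranking a \<sigma>"
    using decreasing_ranking_exists by blast
  then have bij: "bij_betw \<sigma> UNIV {..<CARD('n)}" and mono: "\<And>i j. \<sigma> i \<le> \<sigma> j \<Longrightarrow> a j \<le> a i"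
    by (auto simp: decreasing_ranking_def)
  obtain k where k: "\<theta> \<in> rank_block \<sigma> k"
    using rank_block_ex[OF bij] assms by (metis less_imp_le)
  \<comment> \<open>Dividing by \<open>\<theta>\<close> normalises the total weight to 1 and turns
    the bound 1/n on block weights into the cap 1/(n\<theta>).\<close>
  define \<pi> :: "real ^ 'n" where "\<pi> = (\<chi> i. block_weight \<sigma> \<theta> i / \<theta>)"
  have sum_\<pi>: "(\<Sum>i\<in>UNIV. \<pi> $ i) = 1"
    using sum_block_weight[OF bij] assms by (simp add: \<pi>_def flip: sum_divide_distrib)
  have "\<pi> $ i \<le> inverse (real CARD('n) * \<theta>)" for i
    using divide_right_mono[OF block_weight_le[of \<sigma> \<theta> i], of \<theta>] assms
    by (simp add: \<pi>_def field_simps)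
  moreover have "0 \<le> \<pi> $ i" for i
    using assms by (simp add: \<pi>_def block_weight_def)
  ultimately have mem: "\<pi> \<in> capped_simplex \<theta>"
    using sum_\<pi> by (simp add: capped_simplex_def prob_simplex_def)
  have "(\<Sum>i\<in>UNIV. p $ i * a i) \<le> (\<Sum>i\<in>UNIV. \<pi> $ i * a i)" if p: "p \<in> capped_simplex \<theta>" for p
  proof (rule sum_mult_le_of_threshold)
    show "(\<Sum>i\<in>UNIV. p $ i) = (\<Sum>i\<in>UNIV. \<pi> $ i)"
      using p sum_\<pi> by (simp add: capped_simplex_def prob_simplex_def)
    fix i
    have p_i: "0 \<le> p $ i" "p $ i \<le> inverse (real CARD('n) * \<theta>)"
      using p by (auto simp: capped_simplex_def prob_simplex_def)
    consider "\<sigma> i < \<sigma> k" | "\<sigma> i = \<sigma> k" | "\<sigma> k < \<sigma> i"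
      by linarith
    then show "0 \<le> (\<pi> $ i - p $ i) * (a i - a k)"
    proof cases
      case 1
      then have "\<pi> $ i = inverse (real CARD('n) * \<theta>)"
        using block_weight_before[OF k 1] by (simp add: \<pi>_def inverse_eq_divide)
      with 1 p_i mono show ?thesis
        by (intro mult_nonneg_nonneg) auto
    next
      \<comment> \<open>Here \<open>\<pi> $ i\<close> may lie strictly between 0 and the cap, so the
        first factor has no fixed sign; the threshold \<open>a k\<close> is chosen to make the
        second factor vanish.\<close>
      case 2
      then have "a i = a k"
        using mono by (simp add: order_antisym)
      then show ?thesis
        by simp
    next
      case 3
      then have "\<pi> $ i = 0"
        using block_weight_after[OF k] by (simp add: \<pi>_def)
      with 3 p_i mono show ?thesis
        by (intro mult_nonpos_nonpos) auto
    qed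
  qed
  with mem have "is_arg_max (\<lambda>p. \<Sum>i\<in>UNIV. p $ i * a i) (\<lambda>p. p \<in> capped_simplex \<theta>) \<pi>"
    by (auto simp: is_arg_max_linorder)
  moreover have "empirical_superquantile \<theta> a = (\<Sum>i\<in>UNIV. \<pi> $ i * a i)"
    using superquantile_empirical_law[OF \<sigma> assms(2)] by (simp add: \<pi>_def sum_distrib_left)
  ultimately show ?thesis
    by blast
qed

theorem mainTheorem4:
  fixes F :: "'n::finite \<Rightarrow> real ^ 'd \<Rightarrow> real"
    and lam \<theta> :: real
  assumes "lam \<ge> 0" and "0 < \<theta>" and "\<theta> < 1"
  shows "\<forall>w. \<exists>\<pi>. is_arg_max (\<lambda>p. \<Sum>i\<in>UNIV. p $ i * F i w) (\<lambda>p. p \<in> capped_simplex \<theta>) \<pi>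
           \<and> superquantile_objective F lam \<theta> w
               = (\<Sum>i\<in>UNIV. \<pi> $ i * F i w) + lam / 2 * (norm w)\<^sup>2"
  \<comment> \<open>The quadratic term is independent of the weights, so the result for fixed values
    applies with \<open>a i = F i w\<close>.\<close>
  unfolding superquantile_objective_def
  using superquantile_eq_max_capped_simplex[OF assms(2,3)] by fastforce

end
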